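(* Let $(V,\sigma)$ be a non-trivial $\mathfrak{sl}(2)$-module, with $\sigma:\mathfrak{sl}(2)\to\operatorname{End}(V)$. Let $T\in\operatorname{End}(V)$ be an endomorphism defining an extension $\Phi_>:\mathbf{Witt}_{>}\to\operatorname{End}(V)$ of $\sigma$ (that is, $\Phi_>$ is a Lie algebra representation extending $\sigma$ with $\Phi_>(L_2)=T$), and let $S\in\operatorname{End}(V)$ be an endomorphism defining an extension $\Phi_<:\mathbf{Witt}_{<}\to\operatorname{End}(V)$ of $\sigma$ (that is, $\Phi_<$ is a Lie algebra representation extending $\sigma$ with $\Phi_<(L_{-2})=S$). There is a representation of Lie algebras $\Phi:\mathbf{Vir}\to\operatorname{End}(V)$ such that $\Phi|_{\mathbf{Witt}_{<}}=\Phi_<$ and $\Phi|_{\mathbf{Witt}_{>}}=\Phi_>$ if and only if $$K:=4\sigma(h)-2[S,T]\in\operatorname{End}(V)$$ commutes with $T$ and $S$. Moreover, in this case the central element $C\in\mathbf{Vir}$ is represented by $K$, that is, $\Phi(C)=K$.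
   Context: $\mathfrak{sl}(2)=\mathfrak{sl}(2,\mathbb C)$ has Chevalley basis $\{e,f,h\}$ with $[e,f]=h$, $[h,e]=2e$, $[h,f]=-2f$. $\mathbf{Vir}$ is the complex Lie algebra with basis $\{L_i\}_{i\in\mathbb Z}\cup\{C\}$ and bracket $[L_i,L_j]=(i-j)L_{i+j}+\frac1{12}(i^3-i)\delta_{i+j,0}C$, $[\mathbf{Vir},C]=0$. $\mathbf{Witt}_{>}$ and $\mathbf{Witt}_{<}$ are the Lie algebras with bases $\{L_k\}_{k\ge-1}$ and $\{L_k\}_{k\le 1}$ respectively and bracket $[L_i,L_j]=(i-j)L_{i+j}$; both are subalgebras of $\mathbf{Vir}$. $\mathfrak{sl}(2)$ is embedded in each of these algebras by $f\mapsto L_{-1}$, $h\mapsto -2L_0$, $e\mapsto -L_1$; a representation of one of these algebras extends $\sigma$ if its restriction along this embedding is $\sigma$. $V$ is a complex vector space and $[A,B]=AB-BA$ in $\operatorname{End}(V)$. *)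

theory Defs
  imports "HOL-Analysis.Determinants" "HOL-Library.Poly_Mapping"
begin

section \<open>Complex Lie algebras and their representations\<close>

locale lie_algebra = vector_space smul
  for smul :: "complex \<Rightarrow> 'g::ab_group_add \<Rightarrow> 'g" +
  fixes bracket :: "'g \<Rightarrow> 'g \<Rightarrow> 'g"
  assumes bracket_add_left: "bracket (x + y) z = bracket x z + bracket y z"
    and bracket_add_right: "bracket x (y + z) = bracket x y + bracket x z"
    and bracket_scale_left: "bracket (smul c x) y = smul c (bracket x y)"
    and bracket_scale_right: "bracket x (smul c y) = smul c (bracket x y)"
    and bracket_self: "bracket x x = 0"
    and jacobi: "bracket x (bracket y z) + bracket y (bracket z x) + bracket z (bracket x y) = 0"

definition lie_subalgebra ::
  "(complex \<Rightarrow> 'g::ab_group_add \<Rightarrow> 'g) \<Rightarrow> ('g \<Rightarrow> 'g \<Rightarrow> 'g) \<Rightarrow> 'g set \<Rightarrow> bool"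
  where "lie_subalgebra smul bracket G \<longleftrightarrow>
    module.subspace smul G \<and> (\<forall>x\<in>G. \<forall>y\<in>G. bracket x y \<in> G)"

definition commutator :: "('v::ab_group_add \<Rightarrow> 'v) \<Rightarrow> ('v \<Rightarrow> 'v) \<Rightarrow> 'v \<Rightarrow> 'v"
  where "commutator A B = (\<lambda>v. A (B v) - B (A v))"

text \<open>The Lie algebra being represented is a subalgebra \<open>G\<close> of an ambient Lie algebra;
  the values of \<open>\<rho>\<close> outside \<open>G\<close> are irrelevant.\<close>

definition lie_representation ::
  "(complex \<Rightarrow> 'g::ab_group_add \<Rightarrow> 'g) \<Rightarrow> ('g \<Rightarrow> 'g \<Rightarrow> 'g) \<Rightarrow> 'g set \<Rightarrow>
   (complex \<Rightarrow> 'v::ab_group_add \<Rightarrow> 'v) \<Rightarrow> ('g \<Rightarrow> 'v \<Rightarrow> 'v) \<Rightarrow> bool"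
  where "lie_representation scaleG bracket G scaleV \<rho> \<longleftrightarrow>
    (\<forall>x\<in>G. Vector_Spaces.linear scaleV scaleV (\<rho> x)) \<and>
    (\<forall>x\<in>G. \<forall>y\<in>G. \<rho> (x + y) = (\<lambda>v. \<rho> x v + \<rho> y v)) \<and>
    (\<forall>c. \<forall>x\<in>G. \<rho> (scaleG c x) = (\<lambda>v. scaleV c (\<rho> x v))) \<and>
    (\<forall>x\<in>G. \<forall>y\<in>G. \<rho> (bracket x y) = commutator (\<rho> x) (\<rho> y))"


section \<open>The Lie algebra sl(2)\<close>

type_synonym mat2 = "complex^2^2"

definition mat2_scale :: "complex \<Rightarrow> mat2 \<Rightarrow> mat2"
  where "mat2_scale c A = (\<chi> i j. c * A $ i $ j)"

definition mat2_bracket :: "mat2 \<Rightarrow> mat2 \<Rightarrow> mat2"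
  where "mat2_bracket A B = A ** B - B ** A"

definition sl2 :: "mat2 set"
  where "sl2 = {A. trace A = 0}"

definition sl2_e :: mat2
  where "sl2_e = (\<chi> i j. if i = 1 \<and> j = 2 then 1 else 0)"

definition sl2_f :: mat2
  where "sl2_f = (\<chi> i j. if i = 2 \<and> j = 1 then 1 else 0)"

definition sl2_h :: mat2
  where "sl2_h = (\<chi> i j. if i = j then (if i = 1 then 1 else - 1) else 0)"

lemmas mat2_defs = mat2_scale_def mat2_bracket_def sl2_e_def sl2_f_def sl2_h_def

lemma lie_algebra_mat2: "lie_algebra mat2_scale mat2_bracket"
  by unfold_locales
    (simp_all add: mat2_defs vec_eq_iff matrix_matrix_mult_def forall_2 sum_2 algebra_simps)

lemma lie_subalgebra_sl2: "lie_subalgebra mat2_scale mat2_bracket sl2"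
proof -
  interpret lie_algebra mat2_scale mat2_bracket by (rule lie_algebra_mat2)
  show ?thesis
    unfolding lie_subalgebra_def subspace_def
    by (auto simp: mat2_defs sl2_def trace_def matrix_matrix_mult_def sum_2 algebra_simps
        simp flip: distrib_left)
qed

lemma sl2_basis_in: "sl2_e \<in> sl2" "sl2_f \<in> sl2" "sl2_h \<in> sl2"
  by (simp_all add: sl2_def mat2_defs trace_def sum_2)

lemma sl2_expansion:
  assumes "A \<in> sl2"
  shows "A = mat2_scale (A $ 1 $ 2) sl2_e + mat2_scale (A $ 2 $ 1) sl2_f
    + mat2_scale (A $ 1 $ 1) sl2_h"
  using assms
  by (simp add: sl2_def mat2_defs trace_def sum_2 vec_eq_iff forall_2 eq_neg_iff_add_eq_0 add.commute)

lemma sl2_brackets: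
  "mat2_bracket sl2_e sl2_f = sl2_h"
  "mat2_bracket sl2_h sl2_e = mat2_scale 2 sl2_e"
  "mat2_bracket sl2_h sl2_f = mat2_scale (- 2) sl2_f"
  by (simp_all add: mat2_defs vec_eq_iff matrix_matrix_mult_def forall_2 sum_2)


section \<open>The Virasoro algebra and the subalgebras Witt> and Witt<\<close>

datatype vir_index = L_index int | C_index

text \<open>Formal complex linear combinations of the basis indices.\<close>

type_synonym vir = "vir_index \<Rightarrow>\<^sub>0 complex"

definition vir_L :: "int \<Rightarrow> vir"
  where "vir_L i = Poly_Mapping.single (L_index i) 1"

definition vir_C :: vir
  where "vir_C = Poly_Mapping.single C_index 1"

definition vir_scale :: "complex \<Rightarrow> vir \<Rightarrow> vir"
  where "vir_scale c x = Poly_Mapping.map ((*) c) x"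

fun vir_basis_bracket :: "vir_index \<Rightarrow> vir_index \<Rightarrow> vir" where
  "vir_basis_bracket (L_index i) (L_index j) =
     vir_scale (of_int (i - j)) (vir_L (i + j)) +
     vir_scale (if i + j = 0 then of_int (i ^ 3 - i) / 12 else 0) vir_C"
| "vir_basis_bracket C_index b = 0"
| "vir_basis_bracket a C_index = 0"

definition vir_bracket :: "vir \<Rightarrow> vir \<Rightarrow> vir"
  where "vir_bracket x y =
    (\<Sum>a\<in>Poly_Mapping.keys x. \<Sum>b\<in>Poly_Mapping.keys y.
      vir_scale (Poly_Mapping.lookup x a * Poly_Mapping.lookup y b) (vir_basis_bracket a b))"

text \<open>The central term of \<open>[L\<^sub>i, L\<^sub>j]\<close> vanishes whenever \<open>i, j \<ge> -1\<close> or \<open>i, j \<le> 1\<close>,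
  so the following subspaces of \<^typ>\<open>vir\<close> carry the bracket \<open>[L\<^sub>i, L\<^sub>j] = (i - j) L\<^sub>i\<^sub>+\<^sub>j\<close>;
  see \<open>witt_bracket\<close> below.\<close>

definition witt_gt :: "vir set"
  where "witt_gt = {x. Poly_Mapping.keys x \<subseteq> L_index ` {- 1..}}"

definition witt_lt :: "vir set"
  where "witt_lt = {x. Poly_Mapping.keys x \<subseteq> L_index ` {..1}}"

lemma lookup_vir_scale [simp]:
  "Poly_Mapping.lookup (vir_scale c x) a = c * Poly_Mapping.lookup x a"
  by (simp add: vir_scale_def map.rep_eq when_def)

lemma vector_space_vir: "vector_space vir_scale"
  by unfold_locales (auto intro!: poly_mapping_eqI simp: lookup_add algebra_simps)

interpretation vir: vector_space vir_scale
  by (rule vector_space_vir)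

lemma vir_bracket_superset:
  assumes "finite A" "finite B" "Poly_Mapping.keys x \<subseteq> A" "Poly_Mapping.keys y \<subseteq> B"
  shows "vir_bracket x y = (\<Sum>a\<in>A. \<Sum>b\<in>B.
      vir_scale (Poly_Mapping.lookup x a * Poly_Mapping.lookup y b) (vir_basis_bracket a b))"
proof -
  have "(\<Sum>b\<in>B. vir_scale (Poly_Mapping.lookup x a * Poly_Mapping.lookup y b) (vir_basis_bracket a b))
    = (\<Sum>b\<in>Poly_Mapping.keys y.
        vir_scale (Poly_Mapping.lookup x a * Poly_Mapping.lookup y b) (vir_basis_bracket a b))" for a
    by (rule sum.mono_neutral_right) (use assms in \<open>auto simp: in_keys_iff\<close>)
  moreover have "(\<Sum>a\<in>A. \<Sum>b\<in>Poly_Mapping.keys y.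
        vir_scale (Poly_Mapping.lookup x a * Poly_Mapping.lookup y b) (vir_basis_bracket a b))
    = vir_bracket x y"
    unfolding vir_bracket_def
    by (rule sum.mono_neutral_right) (use assms in \<open>auto simp: in_keys_iff\<close>)
  ultimately show ?thesis by simp
qed

lemma vir_bracket_add_left: "vir_bracket (x + y) z = vir_bracket x z + vir_bracket y z"
proof -
  let ?A = "Poly_Mapping.keys x \<union> Poly_Mapping.keys y" and ?B = "Poly_Mapping.keys z"
  have "Poly_Mapping.keys (x + y) \<subseteq> ?A" by (rule Poly_Mapping.keys_add)
  then show ?thesis
    by (simp add: vir_bracket_superset[of ?A ?B] lookup_add sum.distrib distrib_right
        vir.scale_left_distrib)
qed

lemma vir_bracket_add_right: "vir_bracket x (y + z) = vir_bracket x y + vir_bracket x z"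
proof -
  let ?A = "Poly_Mapping.keys x" and ?B = "Poly_Mapping.keys y \<union> Poly_Mapping.keys z"
  have "Poly_Mapping.keys (y + z) \<subseteq> ?B" by (rule Poly_Mapping.keys_add)
  then show ?thesis
    by (simp add: vir_bracket_superset[of ?A ?B] lookup_add sum.distrib distrib_left
        vir.scale_left_distrib)
qed

lemma keys_vir_scale: "Poly_Mapping.keys (vir_scale c x) \<subseteq> Poly_Mapping.keys x"
  by (auto simp: in_keys_iff)

lemma vir_bracket_scale_left: "vir_bracket (vir_scale c x) y = vir_scale c (vir_bracket x y)"
  by (simp add: vir_bracket_superset[of "Poly_Mapping.keys x" "Poly_Mapping.keys y"]
      keys_vir_scale vir.scale_sum_right mult.assoc)

lemma vir_bracket_scale_right: "vir_bracket x (vir_scale c y) = vir_scale c (vir_bracket x y)"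
  by (simp add: vir_bracket_superset[of "Poly_Mapping.keys x" "Poly_Mapping.keys y"]
      keys_vir_scale vir.scale_sum_right mult_ac)

lemma vir_bracket_basis:
  "vir_bracket (Poly_Mapping.single a 1) (Poly_Mapping.single b 1) = vir_basis_bracket a b"
  by (simp add: vir_bracket_def)

lemma vir_bracket_L_L:
  "vir_bracket (vir_L i) (vir_L j) = vir_scale (of_int (i - j)) (vir_L (i + j)) +
     vir_scale (if i + j = 0 then of_int (i ^ 3 - i) / 12 else 0) vir_C"
  using vir_bracket_basis[of "L_index i" "L_index j"] by (simp add: vir_L_def vir_C_def)

lemma vir_bracket_C: "vir_bracket vir_C x = 0" "vir_bracket x vir_C = 0"
proof -
  have "vir_basis_bracket a C_index = 0" for a by (cases a) auto
  then show "vir_bracket vir_C x = 0" "vir_bracket x vir_C = 0"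
    by (auto simp: vir_bracket_def vir_C_def)
qed

lemma vir_induct [case_names add L C]:
  assumes add: "\<And>x y. P x \<Longrightarrow> P y \<Longrightarrow> P (x + y)"
    and L: "\<And>c i. P (vir_scale c (vir_L i))"
    and C: "\<And>c. P (vir_scale c vir_C)"
  shows "P x"
proof (induction x rule: Poly_Mapping.update_induct)
  case const
  show ?case using C[of 0] by simp
next
  case (update f a b)
  have "Poly_Mapping.update a b f = f + vir_scale b (Poly_Mapping.single a 1)"
    using update.hyps
    by (intro poly_mapping_eqI)
      (auto simp: lookup_update lookup_add lookup_single when_def in_keys_iff)
  moreover have "P (vir_scale b (Poly_Mapping.single a 1))"
    using L C by (cases a) (auto simp: vir_L_def vir_C_def)
  ultimately show ?case using add update by simp
qed

lemma vir_bracket_zero [simp]: "vir_bracket 0 x = 0" "vir_bracket x 0 = 0"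
  by (simp_all add: vir_bracket_def)

lemma vir_bracket_skew: "vir_bracket x y = - vir_bracket y x"
proof (induction x rule: vir_induct)
  case (add x x')
  then show ?case by (simp add: vir_bracket_add_left vir_bracket_add_right)
next
  case (L c i)
  show ?case
  proof (induction y rule: vir_induct)
    case (add y y')
    then show ?case by (simp add: vir_bracket_add_left vir_bracket_add_right)
  next
    case (L d j)
    have "vir_bracket (vir_L i) (vir_L j) = - vir_bracket (vir_L j) (vir_L i)"
    proof (cases "j = - i")
      case True
      then show ?thesis
        by (simp add: vir_bracket_L_L)
          (intro poly_mapping_eqI, simp add: lookup_add field_simps)
    next
      case False
      then have "i + j \<noteq> 0" "j + i \<noteq> 0" by auto
      then show ?thesis
        by (simp add: vir_bracket_L_L add.commute flip: vir.scale_minus_left)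
    qed
    then show ?case
      by (simp add: vir_bracket_scale_left vir_bracket_scale_right mult.commute)
  qed (simp add: vir_bracket_scale_left vir_bracket_scale_right vir_bracket_C)
qed (simp add: vir_bracket_scale_left vir_bracket_scale_right vir_bracket_C)

definition vir_jac :: "vir \<Rightarrow> vir \<Rightarrow> vir \<Rightarrow> vir"
  where "vir_jac x y z = vir_bracket x (vir_bracket y z) + vir_bracket y (vir_bracket z x)
    + vir_bracket z (vir_bracket x y)"

lemma vir_jac_L: "vir_jac (vir_L i) (vir_L j) (vir_L k) = 0"
proof -
  have c: "i + (j + k) = 0 \<longleftrightarrow> i + j + k = 0" "j + (k + i) = 0 \<longleftrightarrow> i + j + k = 0"
    "k + (i + j) = 0 \<longleftrightarrow> i + j + k = 0" "j + (k + i) = i + (j + k)" "k + (i + j) = i + (j + k)"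
    by auto
  show ?thesis
  proof (cases "i + j + k = 0")
    case True
    then have k: "k = - i - j" by simp
    show ?thesis
      unfolding vir_jac_def
      by (simp only: vir_bracket_L_L vir_bracket_add_right vir_bracket_scale_right vir_bracket_C c)
        (intro poly_mapping_eqI,
          simp add: k lookup_add field_simps power3_eq_cube)
  next
    case False
    show ?thesis
      unfolding vir_jac_def
      by (simp only: vir_bracket_L_L vir_bracket_add_right vir_bracket_scale_right vir_bracket_C c)
        (intro poly_mapping_eqI,
          use False in \<open>simp add: lookup_add algebra_simps\<close>)
  qed
qed

lemma vir_jac_add:
  "vir_jac (x + x') y z = vir_jac x y z + vir_jac x' y z"
  "vir_jac x (y + y') z = vir_jac x y z + vir_jac x y' z"
  "vir_jac x y (z + z') = vir_jac x y z + vir_jac x y z'"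
  by (simp_all add: vir_jac_def vir_bracket_add_left vir_bracket_add_right)

lemma vir_jac_scale:
  "vir_jac (vir_scale c x) y z = vir_scale c (vir_jac x y z)"
  "vir_jac x (vir_scale c y) z = vir_scale c (vir_jac x y z)"
  "vir_jac x y (vir_scale c z) = vir_scale c (vir_jac x y z)"
  by (simp_all add: vir_jac_def vir_bracket_scale_left vir_bracket_scale_right
      vir.scale_right_distrib)

lemma vir_jac_C: "vir_jac vir_C y z = 0" "vir_jac x vir_C z = 0" "vir_jac x y vir_C = 0"
  by (simp_all add: vir_jac_def vir_bracket_C)

lemma vir_jac_zero: "vir_jac x y z = 0"
proof -
  have 1: "vir_jac (vir_L i) (vir_L j) z = 0" for i j
    by (induction z rule: vir_induct) (simp_all add: vir_jac_add vir_jac_scale vir_jac_L vir_jac_C)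
  have 2: "vir_jac (vir_L i) y z = 0" for i
    by (induction y rule: vir_induct) (simp_all add: vir_jac_add vir_jac_scale 1 vir_jac_C)
  show ?thesis
    by (induction x rule: vir_induct) (simp_all add: vir_jac_add vir_jac_scale 2 vir_jac_C)
qed

lemma lie_algebra_vir: "lie_algebra vir_scale vir_bracket"
proof unfold_locales
  fix x y z :: vir
  show "vir_bracket x x = 0"
  proof (rule poly_mapping_eqI)
    fix a
    have "Poly_Mapping.lookup (vir_bracket x x) a = - Poly_Mapping.lookup (vir_bracket x x) a"
      by (subst vir_bracket_skew) simp
    then show "Poly_Mapping.lookup (vir_bracket x x) a = Poly_Mapping.lookup 0 a" by simp
  qed
  show "vir_bracket x (vir_bracket y z) + vir_bracket y (vir_bracket z x)
      + vir_bracket z (vir_bracket x y) = 0"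
    using vir_jac_zero by (simp add: vir_jac_def)
qed (simp_all add: vir_bracket_add_left vir_bracket_add_right
    vir_bracket_scale_left vir_bracket_scale_right)

lemma witt_bracket:
  assumes "i \<ge> - 1 \<and> j \<ge> - 1 \<or> i \<le> 1 \<and> j \<le> 1"
  shows "vir_bracket (vir_L i) (vir_L j) = vir_scale (of_int (i - j)) (vir_L (i + j))"
proof -
  have "i \<in> {- 1, 0, 1}" if "i + j = 0" using assms that by auto
  then show ?thesis by (auto simp: vir_bracket_L_L)
qed

lemma subspace_keys: "vir.subspace {x. Poly_Mapping.keys x \<subseteq> A}"
proof (rule vir.subspaceI)
  fix x y :: vir
  assume "x \<in> {x. Poly_Mapping.keys x \<subseteq> A}" "y \<in> {x. Poly_Mapping.keys x \<subseteq> A}"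
  then show "x + y \<in> {x. Poly_Mapping.keys x \<subseteq> A}"
    using Poly_Mapping.keys_add[of x y] by auto
next
  fix c and x :: vir
  assume "x \<in> {x. Poly_Mapping.keys x \<subseteq> A}"
  then show "vir_scale c x \<in> {x. Poly_Mapping.keys x \<subseteq> A}"
    using keys_vir_scale[of c x] by auto
qed simp

lemma witt_closed_aux:
  assumes "\<And>i j. i \<in> I \<Longrightarrow> j \<in> I \<Longrightarrow> i - j \<noteq> 0 \<Longrightarrow> i + j \<in> I"
    and "(\<forall>i\<in>I. i \<ge> - 1) \<or> (\<forall>i\<in>I. i \<le> 1)"
    and x: "Poly_Mapping.keys x \<subseteq> L_index ` I" and y: "Poly_Mapping.keys y \<subseteq> L_index ` I"
  shows "Poly_Mapping.keys (vir_bracket x y) \<subseteq> L_index ` I"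
proof -
  let ?U = "{z::vir. Poly_Mapping.keys z \<subseteq> L_index ` I}"
  have "vir_bracket x y \<in> ?U"
    unfolding vir_bracket_def
  proof (intro vir.subspace_sum[OF subspace_keys] vir.subspace_scale[OF subspace_keys])
    fix a b assume "a \<in> Poly_Mapping.keys x" "b \<in> Poly_Mapping.keys y"
    then obtain i j where ij: "i \<in> I" "j \<in> I" "a = L_index i" "b = L_index j"
      using x y by blast
    have "vir_basis_bracket a b = vir_bracket (vir_L i) (vir_L j)"
      by (simp add: ij vir_L_def flip: vir_bracket_basis)
    also have "\<dots> = vir_scale (of_int (i - j)) (vir_L (i + j))"
      by (rule witt_bracket) (use assms(2) ij in auto)
    also have "\<dots> \<in> ?U"
    proof (cases "i = j")
      case False
      then have "i + j \<in> I" using assms(1) ij by auto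
      then show ?thesis by (intro vir.subspace_scale[OF subspace_keys]) (simp add: vir_L_def)
    qed simp
    finally show "vir_basis_bracket a b \<in> ?U" .
  qed
  then show ?thesis by simp
qed

lemma lie_subalgebra_witt_gt: "lie_subalgebra vir_scale vir_bracket witt_gt"
  unfolding lie_subalgebra_def witt_gt_def
  using witt_closed_aux[of "{- 1..}"] subspace_keys[of "L_index ` {- 1..}"] by auto

lemma lie_subalgebra_witt_lt: "lie_subalgebra vir_scale vir_bracket witt_lt"
  unfolding lie_subalgebra_def witt_lt_def
  using witt_closed_aux[of "{..1}"] subspace_keys[of "L_index ` {..1}"] by auto


section \<open>The embedding of sl(2)\<close>

text \<open>The linear map with \<open>f \<mapsto> L\<^sub>-\<^sub>1\<close>, \<open>h \<mapsto> -2 L\<^sub>0\<close>, \<open>e \<mapsto> -L\<^sub>1\<close>, the coordinates of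
  \<open>A\<close> being those of \<open>sl2_expansion\<close>.\<close>

definition sl2_embed :: "mat2 \<Rightarrow> vir"
  where "sl2_embed A = vir_scale (- (A $ 1 $ 2)) (vir_L 1) + vir_scale (A $ 2 $ 1) (vir_L (- 1))
    + vir_scale (- 2 * A $ 1 $ 1) (vir_L 0)"

lemma sl2_embed_basis:
  "sl2_embed sl2_f = vir_L (- 1)"
  "sl2_embed sl2_h = vir_scale (- 2) (vir_L 0)"
  "sl2_embed sl2_e = - vir_L 1"
  by (simp_all add: sl2_embed_def mat2_defs)

lemma sl2_embed_bracket:
  assumes "A \<in> sl2" "B \<in> sl2"
  shows "sl2_embed (mat2_bracket A B) = vir_bracket (sl2_embed A) (sl2_embed B)"
proof -
  have "A $ 2 $ 2 = - A $ 1 $ 1" "B $ 2 $ 2 = - B $ 1 $ 1"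
    using assms by (auto simp: sl2_def trace_def sum_2 eq_neg_iff_add_eq_0 add.commute)
  then show ?thesis
    by (simp add: sl2_embed_def vir_bracket_add_left vir_bracket_add_right
        vir_bracket_scale_left vir_bracket_scale_right witt_bracket mat2_bracket_def
        matrix_matrix_mult_def sum_2 del: vir.scale_minus_left)
      (intro poly_mapping_eqI, simp add: lookup_add algebra_simps)
qed

lemma sl2_embed_in: "sl2_embed A \<in> witt_gt" "sl2_embed A \<in> witt_lt"
proof -
  have "sl2_embed A \<in> {x. Poly_Mapping.keys x \<subseteq> L_index ` I}" if "{- 1, 0, 1} \<subseteq> I" for I
    unfolding sl2_embed_def
    by (intro vir.subspace_add[OF subspace_keys] vir.subspace_scale[OF subspace_keys])
      (use that in \<open>auto simp: vir_L_def\<close>)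
  from this[of "{- 1..}"] this[of "{..1}"] show "sl2_embed A \<in> witt_gt" "sl2_embed A \<in> witt_lt"
    by (auto simp: witt_gt_def witt_lt_def)
qed

definition extends_sl2 :: "(vir \<Rightarrow> 'v \<Rightarrow> 'v) \<Rightarrow> (mat2 \<Rightarrow> 'v \<Rightarrow> 'v) \<Rightarrow> bool"
  where "extends_sl2 \<Phi> \<sigma> \<longleftrightarrow> (\<forall>A\<in>sl2. \<Phi> (sl2_embed A) = \<sigma> A)"

end

theory Submission
  imports Defs
begin

text \<open>The bracket \<open>[L\<^sub>2, L\<^sub>-\<^sub>2] = 4 L\<^sub>0 + C / 2\<close> together with \<open>h \<mapsto> - 2 L\<^sub>0\<close> forces \<open>C\<close> to act by
  \<open>K = 2 [T, S] - 8 L\<^sub>0\<close>, and since \<open>C\<close> is central, \<open>K\<close> then commutes with \<open>T\<close> and \<open>S\<close>. The content lies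
  in the converse: from \<open>[K, T] = [K, S] = 0\<close> alone one has to deduce that \<open>K\<close> commutes with \<open>L\<^sub>1\<close> and
  \<open>L\<^sub>-\<^sub>1\<close>.

  Put \<open>X = [L\<^sub>1, K]\<close> and \<open>Y = [L\<^sub>-\<^sub>1, K]\<close>. The brackets \<open>[L\<^sub>-\<^sub>2, L\<^sub>n]\<close> with \<open>n \<ge> 3\<close> are computed by writing
  \<open>L\<^sub>n\<close> as an iterated bracket of \<open>L\<^sub>2\<close> with \<open>L\<^sub>1\<close>; they are the expected ones up to terms
  \<open>(ad L\<^sub>1)\<^sup>n\<^sup>-\<^sup>2 K\<close>. But \<open>L\<^sub>5\<close> is also a multiple of \<open>[L\<^sub>2, L\<^sub>3]\<close>, and \<open>L\<^sub>7\<close> of \<open>[L\<^sub>2, L\<^sub>5]\<close>.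
  Comparing the two ways of computing \<open>[L\<^sub>-\<^sub>2, L\<^sub>5]\<close> and \<open>[L\<^sub>-\<^sub>2, L\<^sub>7]\<close> yields two relations for \<open>K\<close>
  (\<open>DM\<close> and \<open>TDM\<close> below). Applying \<open>ad L\<^sub>n\<close> for \<open>\<bar>n\<bar> \<le> 2\<close> to them repeatedly shows that a cubic polynomial
  in \<open>k = ad K\<close> annihilates \<open>X\<close> (\<open>cubic_X\<close>). As \<open>[S, X] = - 3 Y\<close> and \<open>k\<close> commutes with \<open>ad S\<close>, the same
  polynomial annihilates \<open>Y\<close>. The situation is symmetric under \<open>L\<^sub>i \<mapsto> - L\<^sub>-\<^sub>i\<close>, \<open>K \<mapsto> - K\<close>, so the
  polynomial in \<open>- k\<close> annihilates \<open>Y\<close> as well. The two polynomials are coprime, hence \<open>Y = 0\<close>, and then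
  \<open>3 X = [T, Y] = 0\<close> (\<open>X_zero\<close>).

  After that, \<open>K\<close> is central, and all relations \<open>[L\<^sub>i, L\<^sub>-\<^sub>j]\<close> follow from those of \<open>L\<^sub>-\<^sub>2\<close> by induction
  (\<open>virasoro_relations\<close>), so that linear extension from the basis gives the representation.

  The computation takes place in a Lie algebra over the rationals generated by abstract elements
  \<open>L\<^sub>i\<close>; it is applied to the Lie algebra of additive operators on the given space.\<close>

section \<open>Lie algebras over the rationals\<close>

lemma additive_rat_homogeneous:
  fixes s1 :: "rat \<Rightarrow> 'a::ab_group_add \<Rightarrow> 'a" and s2 :: "rat \<Rightarrow> 'b::ab_group_add \<Rightarrow> 'b"
  assumes "vector_space s1" "vector_space s2" and add: "\<And>x y. h (x + y) = h x + h y"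
  shows "h (s1 q x) = s2 q (h x)"
proof -
  interpret v1: vector_space s1 by fact
  interpret v2: vector_space s2 by fact
  have h0: "h 0 = 0" using add[of 0 0] by simp
  have neg: "h (- y) = - h y" for y
    using add[of y "- y"] h0 by (simp add: eq_neg_iff_add_eq_0 add.commute)
  have nat: "h (s1 (of_nat n) y) = s2 (of_nat n) (h y)" for n y
    by (induction n) (simp_all add: h0 add v1.scale_left_distrib v2.scale_left_distrib)
  have int: "h (s1 (of_int m) y) = s2 (of_int m) (h y)" for m y
    by (cases m) (simp_all add: nat neg v1.scale_minus_left v2.scale_minus_left
        del: of_nat_Suc)
  obtain a b where ab: "quotient_of q = (a, b)" by (cases "quotient_of q")
  then have b: "b > 0" and q: "q = of_int a / of_int b"
    using quotient_of_denom_pos quotient_of_div by blast+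
  have "s2 (of_int b) (h (s1 q x)) = h (s1 (of_int a) x)"
    using b by (simp add: q flip: int)
  also have "\<dots> = s2 (of_int b) (s2 q (h x))"
    using b by (simp add: q int)
  finally show ?thesis using b by (simp del: v2.scale_scale)
qed

text \<open>The Jacobi identity is stated as the Leibniz rule for \<^term>\<open>br x\<close>, the form in which it is
  used throughout.\<close>

locale rat_lie_algebra = vector_space scale
  for scale :: "rat \<Rightarrow> 'a::ab_group_add \<Rightarrow> 'a" +
  fixes br :: "'a \<Rightarrow> 'a \<Rightarrow> 'a"
  assumes br_add_left: "br (x + y) z = br x z + br y z"
    and br_add_right: "br x (y + z) = br x y + br x z"
    and br_self: "br x x = 0"
    and br_leibniz: "br x (br y z) = br (br x y) z + br y (br x z)"
begin

lemma scale_vector_space: "vector_space scale" by unfold_locales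

lemma br_scale_left: "br (scale q x) y = scale q (br x y)"
  by (rule additive_rat_homogeneous[OF scale_vector_space scale_vector_space]) (rule br_add_left)

lemma br_scale_right: "br x (scale q y) = scale q (br x y)"
  by (rule additive_rat_homogeneous[OF scale_vector_space scale_vector_space]) (rule br_add_right)

lemma br_minus_left: "br (- x) y = - br x y"
  using br_scale_left[of "-1"] by simp

lemma br_minus_right: "br x (- y) = - br x y"
  using br_scale_right[of x "-1"] by simp

lemma br_diff_left: "br (x - y) z = br x z - br y z"
  using br_add_left[of x "- y"] by (simp add: br_minus_left)

lemma br_diff_right: "br x (y - z) = br x y - br x z"
  using br_add_right[of x y "- z"] by (simp add: br_minus_right)

lemma br_zero [simp]: "br 0 x = 0" "br x 0 = 0"
  using br_diff_left[of 0 0] br_diff_right[of x 0 0] by simp_all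

lemma br_skew: "br x y = - br y x"
proof -
  have "br x (x + y) + br y (x + y) = 0"
    using br_self[of "x + y"] by (simp only: br_add_left)
  then have "br x y + br y x = 0" by (simp add: br_add_right br_self)
  then show ?thesis by (simp only: eq_neg_iff_add_eq_0)
qed

lemmas br_linear = br_add_left br_add_right br_diff_left br_diff_right br_minus_left br_minus_right
  br_scale_left br_scale_right br_self

definition coord :: "'a \<Rightarrow> 'a \<Rightarrow> rat"
  where "coord b x = representation (extend_basis {}) x b"

lemma coord_simps [simp]:
  "coord b (x + y) = coord b x + coord b y" "coord b (x - y) = coord b x - coord b y"
  "coord b (- x) = - coord b x" "coord b (scale q x) = q * coord b x" "coord b 0 = 0"
  using independent_extend_basis[OF independent_empty] span_extend_basis[OF independent_empty]
  by (simp_all add: coord_def representation_add representation_diff representation_neg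
      representation_scale representation_zero)

lemma coord_eqI:
  assumes "\<And>b. coord b x = coord b y"
  shows "x = y"
proof -
  have "representation (extend_basis {}) (x - y) b = 0" for b
    using assms[of b] coord_simps(2)[of b x y] by (simp add: coord_def)
  then have "x - y = 0"
    using sum_nonzero_representation_eq[of "extend_basis {}" "x - y"]
      independent_extend_basis[OF independent_empty] span_extend_basis[OF independent_empty]
    by simp
  then show ?thesis by simp
qed

text \<open>In coordinates, a linear consequence of vector equations becomes a statement of rational linear
  arithmetic, which the arithmetic procedures decide. The steps of the computation below have this
  form.\<close>

lemma lin_combI:
  assumes "a = a'"
    and "\<And>b. coord b a = coord b a' \<Longrightarrow> coord b x = coord b y"
  shows "x = y"
  using assms by (blast intro: coord_eqI)

lemma lin_combI2:
  assumes "a1 = a1'" "a2 = a2'"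
    and "\<And>b. coord b a1 = coord b a1' \<Longrightarrow> coord b a2 = coord b a2' \<Longrightarrow> coord b x = coord b y"
  shows "x = y"
  using assms by (blast intro: coord_eqI)

end

section \<open>Two halves of the Witt algebra glued along sl(2)\<close>

locale witt_pair = rat_lie_algebra scale br
  for scale :: "rat \<Rightarrow> 'a::ab_group_add \<Rightarrow> 'a" and br +
  fixes L :: "int \<Rightarrow> 'a" and K :: 'a
  assumes gt: "- 1 \<le> i \<Longrightarrow> - 1 \<le> j \<Longrightarrow> br (L i) (L j) = scale (of_int (i - j)) (L (i + j))"
    and lt: "i \<le> 1 \<Longrightarrow> j \<le> 1 \<Longrightarrow> br (L i) (L j) = scale (of_int (i - j)) (L (i + j))"
    and K_eq: "K = scale 2 (br (L 2) (L (- 2))) - scale 8 (L 0)"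
    and K_L2: "br K (L 2) = 0"
    and K_Lm2: "br K (L (- 2)) = 0"
begin

text \<open>The elements \<open>X\<close>, \<open>Y\<close>, \<open>W\<close>, \<open>M\<close> have the weights \<open>1\<close>, \<open>-1\<close>, \<open>0\<close>, \<open>2\<close> with respect to \<open>- G\<close>.
  Centrality of \<^term>\<open>K\<close> amounts to \<open>X = 0\<close> and \<open>Y = 0\<close>. A lemma below whose name is a word in these
  letters, such as \<open>FDM\<close> for \<open>F (D M)\<close>, evaluates or reorders that word; the aim is to express
  everything by \<open>k\<close>, \<open>D\<close>, \<open>X\<close> and brackets of elements derived from \<open>X\<close>.\<close>

abbreviation D where "D \<equiv> br (L 1)"
abbreviation F where "F \<equiv> br (L (- 1))"
abbreviation G where "G \<equiv> br (L 0)"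
abbreviation T where "T \<equiv> br (L 2)"
abbreviation S where "S \<equiv> br (L (- 2))"
abbreviation k where "k \<equiv> br K"
abbreviation X where "X \<equiv> D K"
abbreviation Y where "Y \<equiv> F K"
abbreviation W where "W \<equiv> D Y"
abbreviation M where "M \<equiv> D X"

text \<open>The Chevalley-type involution \<open>L\<^sub>i \<mapsto> - L\<^sub>-\<^sub>i\<close> exchanges the two halves. It sends \<open>K\<close> to \<open>- K\<close>, so a
  polynomial identity in \<open>k\<close> acting on \<open>X\<close> turns into one with \<open>- k\<close> acting on \<open>Y\<close>.\<close>

lemma mirror: "witt_pair scale br (\<lambda>i. - L (- i)) (- K)"
proof unfold_locales
  show "br (- K) (- L (- 2)) = 0" "br (- K) (- L (- (- 2))) = 0"
    using K_L2 K_Lm2 by (simp_all add: br_linear)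
  show "- K = scale 2 (br (- L (- 2)) (- L (- (- 2)))) - scale 8 (- L (- 0))"
    by (simp add: br_linear br_skew[of "L (- 2)"] K_eq)
next
  fix i j :: int
  have e: "br (- L (- i)) (- L (- j)) = scale (of_int (i - j)) (- L (- (i + j)))"
    if "br (L (- i)) (L (- j)) = scale (of_int (- i - - j)) (L (- i + - j))"
  proof -
    have "of_int (- i - - j) = - (of_int (i - j) :: rat)" "- i + - j = - (i + j)" by simp_all
    with that show ?thesis by (simp only: br_linear scale_minus_left scale_minus_right minus_minus)
  qed
  show "br (- L (- i)) (- L (- j)) = scale (of_int (i - j)) (- L (- (i + j)))"
    if "- 1 \<le> i" "- 1 \<le> j" by (rule e, rule lt) (use that in auto)
  show "br (- L (- i)) (- L (- j)) = scale (of_int (i - j)) (- L (- (i + j)))"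
    if "i \<le> 1" "j \<le> 1" by (rule e, rule gt) (use that in auto)
qed

lemma leibniz_gt:
  "- 1 \<le> i \<Longrightarrow> - 1 \<le> j \<Longrightarrow> br (L i) (br (L j) x) = br (L j) (br (L i) x) + scale (of_int (i - j)) (br (L (i + j)) x)"
  using br_leibniz[of "L i" "L j" x] gt[of i j] by (simp add: br_linear)

lemma leibniz_lt:
  "i \<le> 1 \<Longrightarrow> j \<le> 1 \<Longrightarrow> br (L i) (br (L j) x) = br (L j) (br (L i) x) + scale (of_int (i - j)) (br (L (i + j)) x)"
  using br_leibniz[of "L i" "L j" x] lt[of i j] by (simp add: br_linear)

lemma TS: "br (L 2) (L (- 2)) = scale 4 (L 0) + scale (1/2) K"
  by (rule lin_combI[OF K_eq]) (simp add: field_simps)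

lemma S_T: "S (T x) = T (S x) - scale 4 (G x) - scale (1/2) (k x)"
  using br_leibniz[of "L 2" "L (- 2)" x] by (simp add: TS br_linear)

lemma FD: "F (D x) = D (F x) - scale 2 (G x)"
  using leibniz_gt[of "- 1" 1 x] by simp
lemma SD: "S (D x) = D (S x) - scale 3 (F x)"
  using leibniz_lt[of "- 2" 1 x] by simp
lemma GD: "G (D x) = D (G x) - D x"
  using leibniz_gt[of 0 1 x] by simp
lemma GF: "G (F x) = F (G x) + F x"
  using leibniz_gt[of 0 "- 1" x] by simp
lemma TD: "T (D x) = D (T x) + br (L 3) x"
  using leibniz_gt[of 2 1 x] by simp
lemma TF: "T (F x) = F (T x) + scale 3 (D x)"
  using leibniz_gt[of 2 "- 1" x] by simp

lemma TK [simp]: "T K = 0" and SK [simp]: "S K = 0"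
  using K_L2 K_Lm2 br_skew[of "L 2" K] br_skew[of "L (- 2)" K] by auto

lemma GK [simp]: "G K = 0"
proof -
  have "br (L 0) (br (L 2) (L (- 2))) = 0"
    using br_leibniz[of "L 0" "L 2" "L (- 2)"] gt[of 0 2] lt[of 0 "- 2"] by (simp add: br_linear)
  then have "br (L 0) (scale 2 (br (L 2) (L (- 2))) - scale 8 (L 0)) = 0"
    by (simp only: br_linear) simp
  then show ?thesis using K_eq by simp
qed

lemma kT: "T (k x) = k (T x)" and kS: "S (k x) = k (S x)"
  using br_leibniz[of "L 2" K x] br_leibniz[of "L (- 2)" K x] by auto

lemma Dk: "D (k x) = br X x + k (D x)" and Fk: "F (k x) = br Y x + k (F x)"
  by (rule br_leibniz)+

lemma TY: "T Y = scale 3 X" and SX: "S X = - scale 3 Y"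
  by (simp_all add: TF SD)

lemma weights: "G X = - X" "G Y = Y" "G W = 0" "G M = - scale 2 M" "G (D M) = - scale 3 (D M)"
   by (simp_all add: GD GF br_linear) (rule coord_eqI, simp)+

lemma kX: "br X K = - k X" by (rule br_skew)

text \<open>From here on the brackets \<open>[L\<^sub>-\<^sub>2, L\<^sub>n]\<close>, which cross the two halves, are found by applying
  \<^term>\<open>S\<close> to \<open>[L\<^sub>1, L\<^sub>n\<^sub>-\<^sub>1]\<close>. They deviate from the Witt value by a multiple of
  \<open>D\<^sup>n\<^sup>-\<^sup>2 K\<close>.\<close>

lemma SL3: "S (L 3) = - scale 5 (L 1) + scale (1/2) X"
  by (rule lin_combI[OF S_T[of "L 1"]]) (simp add: gt lt br_linear br_skew[of K "L 1"])

lemma SL4: "S (L 4) = - scale 6 (L 2) - scale (1/4) M"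
  by (rule lin_combI[OF SD[of "L 3"]]) (simp add: SL3 gt br_linear field_simps)

lemma SL5: "S (L 5) = - scale 7 (L 3) + scale (1/12) (D M)"
  by (rule lin_combI[OF SD[of "L 4"]]) (simp add: SL4 gt br_linear field_simps)

lemma SL6: "S (L 6) = - scale 8 (L 4) - scale (1/48) (D (D M))"
  by (rule lin_combI[OF SD[of "L 5"]]) (simp add: SL5 gt br_linear field_simps)

lemma SL7: "S (L 7) = - scale 9 (L 5) + scale (1/240) (D (D (D M)))"
  by (rule lin_combI[OF SD[of "L 6"]]) (simp add: SL6 gt br_linear field_simps)

lemma L3K: "br (L 3) K = T X"
  using TD[of K] by simp

text \<open>Here \<open>L\<^sub>5\<close> is obtained from \<open>[L\<^sub>2, L\<^sub>3]\<close> instead of \<open>[L\<^sub>1, L\<^sub>4]\<close>. The agreement of the two values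
  of \<open>[L\<^sub>-\<^sub>2, L\<^sub>5]\<close> is a genuine constraint on \<open>K\<close>: the relation of weight \<open>5\<close>.\<close>

lemma DM: "D M = - scale 12 (T X)"
  by (rule lin_combI[OF S_T[of "L 3"]])
    (simp add: SL3 SL5 L3K gt br_linear br_skew[of K "L 3"] field_simps)

lemma TX: "T X = - scale (1/12) (D M)"
  by (rule lin_combI[OF DM]) simp

lemma FX: "F X = W"
  by (simp add: FD)

lemma FM: "F M = D W + scale 2 X"
  by (simp add: FD FX weights br_linear)

text \<open>Apply \<^term>\<open>S\<close> to the relation of weight \<open>5\<close>.\<close>

lemma DW: "D W = - scale (22/3) X - scale (2/3) (k X)"
proof -
  have "S (br (L 3) K) = - S (scale (1/12) (D M))"
    by (simp add: L3K TX br_linear)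
  moreover have "S (br (L 3) K) = - scale 5 X - scale (1/2) (k X)"
    using br_leibniz[of "L (- 2)" "L 3" K] by (simp add: SL3 br_linear kX)
  ultimately have "- scale 5 X - scale (1/2) (k X) = - S (scale (1/12) (D M))" by simp
  then show ?thesis
    by (rule lin_combI) (simp add: SD SX FX FM br_linear field_simps)
qed

lemma FW: "F W = - scale (22/3) Y + scale (2/3) (k Y)"
proof -
  interpret m: witt_pair scale br "\<lambda>i. - L (- i)" "- K" by (rule mirror)
  show ?thesis using m.DW FX by (simp add: br_linear)
qed

text \<open>Since \<open>F\<close> and \<open>D\<close> commute in weight \<open>0\<close>, the formulas for \<open>D W\<close> and \<open>F W\<close> must give the same
  \<open>F (D W) = D (F W)\<close>. The two expansions agree in \<open>W\<close> and \<open>[X, Y]\<close>, whereas \<open>k W\<close> enters them with opposite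
  signs.\<close>

lemma kW: "k W = 0"
  by (rule lin_combI[OF FD[of W]])
    (simp add: DW FW FX weights Fk Dk br_linear br_skew[of Y X] field_simps)

lemma FM_X: "F M = - scale (16/3) X - scale (2/3) (k X)"
  by (rule lin_combI[OF FM]) (simp add: DW field_simps)

lemma FDM: "F (D M) = - scale (4/3) M - scale (2/3) (k M)"
  by (rule lin_combI[OF FD[of M]]) (simp add: FM_X weights br_linear Dk field_simps)

lemma TW: "T W = scale (28/9) M + scale (1/18) (k M)"
  by (rule lin_combI[OF TF[of X]]) (simp add: FX TX FDM br_linear field_simps)

text \<open>Apply \<^term>\<open>T\<close>, which commutes with \<^term>\<open>k\<close>, to \<^prop>\<open>k W = 0\<close>.\<close>

lemma kkM: "k (k M) = - scale 56 (k M)"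
proof -
  have "T (k W) = 0" by (simp add: kW)
  then show ?thesis
    by (rule lin_combI) (simp add: kT TW br_linear field_simps)
qed

text \<open>The second constraint, of weight \<open>7\<close>: \<open>L\<^sub>7\<close> obtained from \<open>[L\<^sub>2, L\<^sub>5]\<close> instead of \<open>[L\<^sub>1, L\<^sub>6]\<close>.\<close>

lemma L5K: "br (L 5) K = - scale (1/120) (D (D (D M)))" and TDM: "T (D M) = - scale (1/10) (D (D (D M)))"
proof -
  have "br (L 2) (br (L 3) K) = - br (L 5) K"
    using leibniz_gt[of 2 3 K] by simp
  then have L5K': "br (L 5) K = scale (1/12) (T (D M))"
    by (rule lin_combI) (simp add: L3K TX br_linear)
  have "S (T (L 5)) = T (S (L 5)) - scale 4 (G (L 5)) - scale (1/2) (k (L 5))" by (rule S_T)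
  then show TDM: "T (D M) = - scale (1/10) (D (D (D M)))"
    by (rule lin_combI) (simp add: SL7 SL5 gt br_linear br_skew[of K "L 5"] L5K' field_simps)
  show "br (L 5) K = - scale (1/120) (D (D (D M)))" 
    by (rule coord_eqI) (simp add: L5K' TDM)
qed

lemma L3X: "br (L 3) X = - scale (1/12) (D (D M)) + scale 2 (br (L 4) K)"
  using leibniz_gt[of 3 1 K] by (simp add: L3K TX br_linear)

lemma TM: "T M = - scale (1/6) (D (D M)) + scale 2 (br (L 4) K)"
  by (rule lin_combI[OF TD[of X]]) (simp add: L3X TX br_linear field_simps)

lemma DL4K: "D (br (L 4) K) = scale (1/30) (D (D (D M)))"
proof -
  have L4X: "br (L 4) X = D (br (L 4) K) + scale 3 (br (L 5) K)"
    using leibniz_gt[of 4 1 K] by simp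
  have L3M: "br (L 3) M = D (br (L 3) X) + scale 2 (br (L 4) X)"
    using leibniz_gt[of 3 1 X] by simp
  show ?thesis
    by (rule lin_combI[OF TD[of M]])
      (simp add: TDM TM L3M L4X L3X L5K br_linear field_simps)
qed

text \<open>The constraint of weight \<open>7\<close> amounts to \<open>D U = 0\<close>. The combination is useful because both \<open>S U\<close> and
  \<open>F U\<close> can be computed, and \<open>S D = D S - 3 F\<close> relates them.\<close>

definition U where "U = T M + scale (1/10) (D (D M))"

lemma DU: "D U = 0"
  by (rule coord_eqI) (simp add: U_def TM DL4K br_linear field_simps)

lemma SM: "S M = - scale 6 W"
  by (rule coord_eqI) (simp add: SD SX FX br_linear)

lemma SDM: "S (D M) = scale 60 X + scale 6 (k X)"
  by (rule coord_eqI) (simp add: SD[of M] SM FM_X DW br_linear field_simps)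

lemma SU: "S U = - scale (64/15) M - scale (1/30) (k M)"
  by (rule coord_eqI)
    (simp add: U_def S_T SM TW weights SD[of "D M"] SDM FDM Dk br_linear field_simps)

lemma FU: "F U = - scale (94/45) (D M) - scale (1/90) (k (D M)) - scale (1/15) (br X M)"
proof -
  have FDDM: "F (D (D M)) = scale (14/3) (D M) - scale (2/3) (br X M) - scale (2/3) (k (D M))"
    by (rule lin_combI[OF FD[of "D M"]]) (simp add: FDM weights br_linear Dk field_simps)
  show ?thesis
    by (rule lin_combI[OF TF[of M]])
      (simp add: U_def FDDM FM_X TX kT br_linear field_simps)
qed

text \<open>Apply \<^term>\<open>S\<close> to \<^prop>\<open>D U = 0\<close>. This is the first relation that evaluates a bracket of two
  elements derived from \<open>K\<close>; applying \<open>F\<close> and \<open>S\<close> to it produces the next two.\<close>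

lemma XM: "br X M = - scale 12 (D M)"
  by (rule lin_combI[OF SD[of U]]) (simp add: DU SU FU Dk br_linear field_simps)

lemma XkX: "br X (k X) = scale 11 (k M) - scale 8 M"
proof -
  have kDW: "k (D W) = - br X W" using Dk[of W] by (simp add: kW eq_neg_iff_add_eq_0 add.commute)
  have e1: "D (k (D W)) = - D (br X W)" by (simp add: kDW br_linear)
  have MW: "br M W = scale (4/3) (br X (k X)) + scale (22/3) (k M) + scale (2/3) (k (k M))"
    by (rule lin_combI[OF e1]) (simp add: Dk DW br_leibniz[of "L 1" X W] br_linear field_simps)
  have FXM: "F (br X M) = br W M + br X (F M)" using br_leibniz[of "L (- 1)" X M] FX by simp
  have "F (br X M) = F (- scale 12 (D M))" by (simp add: XM)
  then show ?thesis
    by (rule lin_combI) (simp add: FXM FM_X FDM br_skew[of W M] MW kkM br_linear field_simps)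
qed

lemma XW: "br X W = - k (D W)"
  using Dk[of W] by (simp add: kW eq_neg_iff_add_eq_0)

lemma YM: "br Y M = scale 240 X + scale (28/3) (k X) - scale (4/3) (k (k X))"
proof -
  have SXM: "S (br X M) = br (S X) M + br X (S M)" by (rule br_leibniz)
  have "S (br X M) = S (- scale 12 (D M))" by (simp add: XM)
  then show ?thesis
    by (rule lin_combI) (simp add: SXM SX SM XW DW SDM br_linear field_simps)
qed

text \<open>Apply \<^term>\<open>F\<close> to the formula for \<open>[X, W]\<close>.\<close>

lemma k_XY: "k (br X Y) = 0"
proof -
  have FDW: "F (D W) = - scale (22/3) W + scale (2/3) (br X Y)"
    by (simp add: DW FX Fk kW br_linear br_skew[of Y X])
  have "br X (F W) = F (br X W)"
    using br_leibniz[of "L (- 1)" X W] by (simp add: FX br_self)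
  also have "\<dots> = - F (k (D W))" by (simp add: XW br_linear)
  finally have e1: "br X (F W) = - F (k (D W))" .
  have e2: "k (br X Y) = br (k X) Y + br X (k Y)" by (rule br_leibniz)
  show ?thesis
    by (rule lin_combI2[OF e1 e2])
      (simp add: Fk FDW, simp add: DW FW br_linear kW br_skew[of Y X] br_skew[of Y "k X"] field_simps)
qed

text \<open>Apply \<^term>\<open>F\<close> to the formula for \<open>[X, k X]\<close>. Both sides are polynomials in \<open>k\<close> applied to \<open>X\<close>.\<close>

lemma cubic_X: "scale 2 (k (k (k X))) + scale 19 (k (k X)) = scale 434 (k X) + scale 4024 X"
proof -
  define B where "B = br X Y"
  have kB: "k B = 0" by (simp add: B_def k_XY)
  have XB: "br X B = - k (D B)" using Dk[of B] by (simp add: kB eq_neg_iff_add_eq_0)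
  have DB: "D B = - br Y M + br X W" using br_leibniz[of "L 1" X Y] by (simp add: B_def br_skew[of M Y])
  have kkW: "br W (k X) = - k (br X W)" using br_leibniz[of K W X]
    by (simp add: kW br_skew[of X W] br_linear)
  have FkX: "F (br X (k X)) = br W (k X) - br X B"
    using br_leibniz[of "L (- 1)" X "k X"] by (simp add: FX Fk kW B_def br_skew[of Y X] br_linear)
  have "F (br X (k X)) = F (scale 11 (k M) - scale 8 M)" by (simp add: XkX)
  then show ?thesis
    by (rule lin_combI)
     (simp add: FkX kkW XB DB XW Fk YM FM_X DW br_linear field_simps)
qed

text \<open>The operator \<^term>\<open>S\<close> carries the cubic relation from \<open>X\<close> to \<open>Y\<close> unchanged, whereas the involution carries
  it there with \<open>k\<close> replaced by \<open>- k\<close>. Hence \<open>19 k\<^sup>2 - 4024\<close> and \<open>k\<^sup>3 - 217 k\<close> both kill \<open>Y\<close>, and these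
  polynomials are coprime.\<close>

theorem X_zero: "X = 0"
  and Y_zero: "Y = 0"
proof -
  interpret m: witt_pair scale br "\<lambda>i. - L (- i)" "- K" by (rule mirror)
  have Y1: "- scale 2 (k (k (k Y))) + scale 19 (k (k Y)) = - scale 434 (k Y) + scale 4024 Y"
    using m.cubic_X by (simp add: br_linear)
  have "S (scale 2 (k (k (k X))) + scale 19 (k (k X))) = S (scale 434 (k X) + scale 4024 X)"
    by (simp add: cubic_X)
  then have Y2: "scale 2 (k (k (k Y))) + scale 19 (k (k Y)) = scale 434 (k Y) + scale 4024 Y"
    by (rule lin_combI) (simp add: kS SX br_linear)
  have kkY: "k (k Y) = scale (4024/19) Y"
    by (rule lin_combI2[OF Y1 Y2]) (simp add: field_simps)
  have kkkY: "k (k (k Y)) = scale 217 (k Y)"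
    by (rule lin_combI2[OF Y1 Y2]) (simp add: field_simps)
  have kY: "k Y = 0"
    by (rule lin_combI[OF kkkY]) (simp add: kkY br_linear)
  show Y: "Y = 0"
    using kkY by (simp add: kY)
  show "X = 0"
    by (rule lin_combI[OF TY]) (simp add: Y)
qed
end

section \<open>The Virasoro relations\<close>

context witt_pair
begin

lemma k_Lpos: "1 \<le> n \<Longrightarrow> br K (L n) = 0"
proof (induction n rule: int_ge_induct)
  case base
  show ?case using br_skew[of K "L 1"] X_zero by simp
next
  case (step n)
  show ?case
  proof (cases "n = 1")
    case True
    then show ?thesis using K_L2 by simp
  next
    case False
    have "D (L n) = scale (of_int (1 - n)) (L (n + 1))"
      using step.hyps gt[of 1 n] by (simp add: add.commute)
    moreover have "k (D (L n)) = 0"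
      using br_leibniz[of K "L 1" "L n"] step.IH br_skew[of K "L 1"] X_zero by simp
    ultimately have "scale (of_int (1 - n)) (k (L (n + 1))) = 0" by (simp only: br_linear)
    moreover have "of_int (1 - n) \<noteq> (0 :: rat)" using False by (simp only: of_int_eq_0_iff)
    ultimately show ?thesis by (simp only: scale_eq_0_iff) simp
  qed
qed

theorem K_central: "br K (L n) = 0"
proof -
  interpret m: witt_pair scale br "\<lambda>i. - L (- i)" "- K" by (rule mirror)
  consider "n \<ge> 1" | "n = 0" | "- n \<ge> 1" by linarith
  then show ?thesis
  proof cases
    case 3
    then show ?thesis using m.k_Lpos[of "- n"] by (simp add: br_linear)
  qed (use k_Lpos br_skew[of K "L 0"] in simp_all)
qed

lemma F_L: "F (L n) = scale (of_int (- 1 - n)) (L (n - 1))"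
proof (cases "- 1 \<le> n")
  case True
  then show ?thesis using gt[of "- 1" n] by simp
next
  case False
  then show ?thesis using lt[of "- 1" n] by simp
qed

text \<open>Once \<^prop>\<open>X = 0\<close>, the deviations of \<open>[L\<^sub>-\<^sub>2, L\<^sub>n]\<close> from the Witt value disappear for \<open>n \<ge> 3\<close>.\<close>

lemma S_L_ge3: "3 \<le> n \<Longrightarrow> S (L n) = scale (of_int (- 2 - n)) (L (n - 2))"
proof (induction n rule: int_ge_induct)
  case base
  show ?case using SL3 X_zero by simp
next
  case (step n)
  have D1: "D (L n) = scale (of_int (1 - n)) (L (n + 1))"
    using step.hyps gt[of 1 n] by (simp add: add.commute)
  have D2: "D (L (n - 2)) = scale (of_int (3 - n)) (L (n - 1))"
    using step.hyps gt[of 1 "n - 2"] by simp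
  have "scale (of_int (1 - n)) (S (L (n + 1)))
      = scale (of_int (1 - n)) (scale (of_int (- 2 - (n + 1))) (L (n + 1 - 2)))"
    using SD[of "L n"]
    by (intro coord_eqI, simp only: D1 step.IH F_L br_linear D2 coord_simps) (simp add: algebra_simps)
  moreover have "of_int (1 - n) \<noteq> (0 :: rat)" using step.hyps by (simp only: of_int_eq_0_iff)
  ultimately show ?case by (simp only: scale_left_imp_eq)
qed

text \<open>Induction on \<open>m\<close>: \<open>L\<^sub>-\<^sub>m\<^sub>-\<^sub>1\<close> is a multiple of \<open>[L\<^sub>-\<^sub>1, L\<^sub>-\<^sub>m]\<close>, and the central term obeys the recursion
  \<open>(m - 1) c (m + 1) = (m + 2) c m\<close>, solved by \<open>c m = (m\<^sup>3 - m) / 12\<close>.\<close>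

lemma neg_pos_bracket:
  assumes "2 \<le> m" "- 1 \<le> i"
  shows "br (L (- m)) (L i) = - scale (of_int (i + m)) (L (i - m))
     - scale (if i = m then of_int (m ^ 3 - m) / 12 else 0) K"
  using assms
proof (induction m arbitrary: i rule: int_ge_induct)
  case base
  consider "i \<le> 1" | "i = 2" | "i \<ge> 3" by linarith
  then show ?case
  proof cases
    case 1
    then show ?thesis by (intro coord_eqI) (simp add: lt algebra_simps)
  next
    case 2
    then show ?thesis using TS br_skew[of "L (- 2)" "L 2"] by simp
  next
    case 3
    then show ?thesis by (intro coord_eqI) (simp add: S_L_ge3 algebra_simps)
  qed
next
  case (step m)
  have F1: "F (L (- m)) = scale (of_int (m - 1)) (L (- (m + 1)))"
    using F_L[of "- m"] by simp
  have FL: "br (L (- m)) (F (L i)) =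
     scale (of_int (- 1 - i)) (- scale (of_int (i - 1 + m)) (L (i - 1 - m))
     - scale (if i - 1 = m then of_int (m ^ 3 - m) / 12 else 0) K)"
  proof (cases "i = - 1")
    case False
    then show ?thesis using step.IH[of "i - 1"] step.prems by (simp only: F_L br_linear)
  qed (simp add: F_L)
  have FK: "F K = 0" by (rule Y_zero)
  have "scale (of_int (m - 1)) (br (L (- (m + 1))) (L i)) = F (br (L (- m)) (L i)) - br (L (- m)) (F (L i))"
    using br_leibniz[of "L (- 1)" "L (- m)" "L i"] by (simp add: F1 br_linear)
  also have "\<dots> = scale (of_int (m - 1)) (- scale (of_int (i + (m + 1))) (L (i - (m + 1)))
     - scale (if i = m + 1 then of_int ((m + 1) ^ 3 - (m + 1)) / 12 else 0) K)"
  proof -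
    have e: "i - m - 1 = i - 1 - m" "i - (m + 1) = i - 1 - m" "i - 1 = m \<longleftrightarrow> i = m + 1" by auto
    show ?thesis
      unfolding FL step.IH[OF step.prems] e
      by (intro coord_eqI) (simp add: br_linear FK F_L e, simp add: field_simps power3_eq_cube)
  qed
  finally have *: "scale (of_int (m - 1)) (br (L (- (m + 1))) (L i))
     = scale (of_int (m - 1)) (- scale (of_int (i + (m + 1))) (L (i - (m + 1)))
     - scale (if i = m + 1 then of_int ((m + 1) ^ 3 - (m + 1)) / 12 else 0) K)" .
  have "of_int (m - 1) \<noteq> (0 :: rat)" using step.hyps by (simp only: of_int_eq_0_iff)
  then show ?case using * by (simp only: scale_left_imp_eq)
qed

theorem virasoro_relations:
  "br (L i) (L j) = scale (of_int (i - j)) (L (i + j))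
     + scale (if i + j = 0 then of_int (i ^ 3 - i) / 12 else 0) K"
proof -
  have opposite: "br (L i) (L j) = scale (of_int (i - j)) (L (i + j))
     + scale (if i + j = 0 then of_int (i ^ 3 - i) / 12 else 0) K" if "i \<le> - 2" "- 1 \<le> j" for i j
  proof -
    have eqs: "j - - i = i + j" "j = - i \<longleftrightarrow> i + j = 0" by (simp, linarith)
    have "br (L i) (L j) = - scale (of_int (j + - i)) (L (j - - i))
      - scale (if j = - i then of_int ((- i) ^ 3 - - i) / 12 else 0) K"
      using neg_pos_bracket[of "- i" j] that by simp
    from this[unfolded eqs] show ?thesis
      by (rule lin_combI) (auto simp: field_simps)
  qed
  have small: "i = - 1 \<or> i = 0 \<or> i = 1" if "- 1 \<le> i" "i \<le> 1" using that by auto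
  consider "- 1 \<le> i" "- 1 \<le> j" | "i \<le> 1" "j \<le> 1" | "i \<le> - 2" "- 1 \<le> j" | "- 1 \<le> i" "j \<le> - 2"
    by linarith
  then show ?thesis
  proof cases
    case 1
    then have "i + j = 0 \<Longrightarrow> i ^ 3 - i = 0" using small by force
    then show ?thesis using gt[OF 1] by (simp split: if_splits)
  next
    case 2
    then have "i + j = 0 \<Longrightarrow> i ^ 3 - i = 0" using small by force
    then show ?thesis using lt[OF 2] by (simp split: if_splits)
  next
    case 3
    then show ?thesis by (rule opposite)
  next
    case 4
    have eqs: "j + i = i + j" by simp
    have "br (L i) (L j) = - br (L j) (L i)" by (rule br_skew)
    also have "\<dots> = scale (of_int (i - j)) (L (i + j))
      + scale (if i + j = 0 then of_int (i ^ 3 - i) / 12 else 0) K"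
    proof (rule lin_combI[OF opposite[OF 4(2,1), unfolded eqs]])
      fix b
      assume b: "coord b (br (L j) (L i)) = coord b (scale (of_int (j - i)) (L (i + j))
          + scale (if i + j = 0 then of_int (j ^ 3 - j) / 12 else 0) K)"
      show "coord b (- br (L j) (L i)) = coord b (scale (of_int (i - j)) (L (i + j))
          + scale (if i + j = 0 then of_int (i ^ 3 - i) / 12 else 0) K)"
      proof (cases "i + j = 0")
        case True
        then have "j = - i" by simp
        then show ?thesis using b by (simp add: field_simps)
      next
        case False
        then show ?thesis using b by (simp add: field_simps)
      qed
    qed
    finally show ?thesis .
  qed
qed

end

section \<open>The Lie algebra of additive operators\<close>

text \<open>The scalar multiplication of the vector space is a variable, so its linear operators do not form a
  type, whereas the additive operators do. Additivity already implies compatibility with rational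
  scalars, so they still form a Lie algebra over the rationals; this is why the computation above
  is carried out over that field.\<close>

typedef (overloaded) 'v endo = "{f :: 'v::ab_group_add \<Rightarrow> 'v. \<forall>x y. f (x + y) = f x + f y}"
  morphisms app Endo
  by (rule exI[of _ "\<lambda>v. 0"]) simp

setup_lifting type_definition_endo

instantiation endo :: (ab_group_add) ab_group_add
begin

lift_definition zero_endo :: "'a endo" is "\<lambda>v. 0" by simp
lift_definition plus_endo :: "'a endo \<Rightarrow> 'a endo \<Rightarrow> 'a endo" is "\<lambda>f g v. f v + g v"
  by (simp add: algebra_simps)
lift_definition minus_endo :: "'a endo \<Rightarrow> 'a endo \<Rightarrow> 'a endo" is "\<lambda>f g v. f v - g v"
  by (simp add: algebra_simps)
lift_definition uminus_endo :: "'a endo \<Rightarrow> 'a endo" is "\<lambda>f v. - f v"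
  by simp

instance by standard (transfer, simp add: fun_eq_iff algebra_simps)+

end

lift_definition endo_bracket :: "'v::ab_group_add endo \<Rightarrow> 'v endo \<Rightarrow> 'v endo" is commutator
  by (simp add: commutator_def)

definition endo_scale :: "(complex \<Rightarrow> 'v \<Rightarrow> 'v) \<Rightarrow> rat \<Rightarrow> 'v::ab_group_add endo \<Rightarrow> 'v endo"
  where "endo_scale smul q f = Endo (\<lambda>v. smul (of_rat q) (app f v))"

lemma app_add: "app f (x + y) = app f x + app f y"
  using app[of f] by simp

lemma app_diff: "app f (x - y) = app f x - app f y"
  using app_add[of f "x - y" y] by simp

lemma app_endo_scale:
  assumes "vector_space smul"
  shows "app (endo_scale smul q f) v = smul (of_rat q) (app f v)"
proof -
  interpret vector_space smul by fact
  show ?thesis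
    unfolding endo_scale_def by (subst Endo_inverse) (simp_all add: app_add scale_right_distrib)
qed

lemma rat_lie_algebra_endo:
  assumes "vector_space smul"
  shows "rat_lie_algebra (endo_scale smul) endo_bracket"
proof -
  interpret vector_space smul by fact
  note [simp] = app_endo_scale[OF assms] app_add app_diff endo_bracket.rep_eq plus_endo.rep_eq
    minus_endo.rep_eq zero_endo.rep_eq
  show ?thesis
    by unfold_locales
      (simp_all add: app_inject[symmetric] fun_eq_iff commutator_def of_rat_add of_rat_mult algebra_simps)
qed

section \<open>Representations of the Virasoro algebra from operators\<close>

definition vir_extend :: "(complex \<Rightarrow> 'v::ab_group_add \<Rightarrow> 'v) \<Rightarrow> (vir_index \<Rightarrow> 'v \<Rightarrow> 'v) \<Rightarrow> vir \<Rightarrow> 'v \<Rightarrow> 'v"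
  where "vir_extend smul \<phi> x v =
    (\<Sum>a\<in>Poly_Mapping.keys x. smul (Poly_Mapping.lookup x a) (\<phi> a v))"

context
  fixes smul :: "complex \<Rightarrow> 'v::ab_group_add \<Rightarrow> 'v"
  assumes vector_space: "vector_space smul"
begin

interpretation V: vector_space smul by (rule vector_space)

lemma vir_extend_superset:
  assumes "finite A" "Poly_Mapping.keys x \<subseteq> A"
  shows "vir_extend smul \<phi> x v = (\<Sum>a\<in>A. smul (Poly_Mapping.lookup x a) (\<phi> a v))"
  unfolding vir_extend_def
  by (rule sum.mono_neutral_left) (use assms in \<open>auto simp: in_keys_iff\<close>)

lemma vir_extend_add: "vir_extend smul \<phi> (x + y) v = vir_extend smul \<phi> x v + vir_extend smul \<phi> y v"
proof -
  let ?A = "Poly_Mapping.keys x \<union> Poly_Mapping.keys y"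
  have "Poly_Mapping.keys (x + y) \<subseteq> ?A" by (rule Poly_Mapping.keys_add)
  then show ?thesis
    by (simp add: vir_extend_superset[of ?A] lookup_add V.scale_left_distrib sum.distrib)
qed

lemma vir_extend_scale: "vir_extend smul \<phi> (vir_scale c x) v = smul c (vir_extend smul \<phi> x v)"
  by (simp add: vir_extend_superset[of "Poly_Mapping.keys x"] keys_vir_scale V.scale_sum_right)

lemma vir_extend_basis:
  "vir_extend smul \<phi> (vir_L i) v = \<phi> (L_index i) v" "vir_extend smul \<phi> vir_C v = \<phi> C_index v"
  by (simp_all add: vir_extend_def vir_L_def vir_C_def)

lemma linear_iff_add_scale:
  "Vector_Spaces.linear smul smul f \<longleftrightarrow>
    (\<forall>x y. f (x + y) = f x + f y) \<and> (\<forall>c x. f (smul c x) = smul c (f x))"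
  by (simp add: Vector_Spaces.linear_iff vector_space)

lemma linear_vir_extend:
  assumes "\<And>a. Vector_Spaces.linear smul smul (\<phi> a)"
  shows "Vector_Spaces.linear smul smul (vir_extend smul \<phi> x)"
  using assms
  by (simp add: linear_iff_add_scale vir_extend_def V.scale_right_distrib sum.distrib
      V.scale_sum_right mult.commute)

lemma commutator_vir_extend:
  assumes lin: "\<And>a. Vector_Spaces.linear smul smul (\<phi> a)"
    and LL: "\<And>i j v. commutator (\<phi> (L_index i)) (\<phi> (L_index j)) v
      = smul (of_int (i - j)) (\<phi> (L_index (i + j)) v)
        + smul (if i + j = 0 then of_int (i ^ 3 - i) / 12 else 0) (\<phi> C_index v)"
    and CL: "\<And>i v. commutator (\<phi> C_index) (\<phi> (L_index i)) v = 0"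
  shows "vir_extend smul \<phi> (vir_bracket x y) v
    = commutator (vir_extend smul \<phi> x) (vir_extend smul \<phi> y) v"
proof -
  let ?E = "vir_extend smul \<phi>"
  let ?P = "\<lambda>x y. \<forall>v. ?E (vir_bracket x y) v = commutator (?E x) (?E y) v"
  have E_lin: "?E x (u + v) = ?E x u + ?E x v" "?E x (smul c v) = smul c (?E x v)" for x u v c
    using linear_vir_extend[of \<phi> x] lin by (simp_all add: linear_iff_add_scale)
  have add_left: "?P (x + x') y" if "?P x y" "?P x' y" for x x' y
    using that by (simp add: vir_bracket_add_left vir_extend_add commutator_def E_lin)
  have add_right: "?P x (y + y')" if "?P x y" "?P x y'" for x y y'
    using that by (simp add: vir_bracket_add_right vir_extend_add commutator_def E_lin)
  have scale_left: "?P (vir_scale c x) y" if "?P x y" for c x y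
    using that by (simp add: vir_bracket_scale_left vir_extend_scale commutator_def E_lin
        V.scale_right_diff_distrib)
  have scale_right: "?P x (vir_scale c y)" if "?P x y" for c x y
    using that by (simp add: vir_bracket_scale_right vir_extend_scale commutator_def E_lin
        V.scale_right_diff_distrib)
  have E0: "?E 0 v = 0" for v by (simp add: vir_extend_def)
  have LL': "?P (vir_L i) (vir_L j)" for i j
    using LL[of i j]
    by (simp only: vir_bracket_L_L vir_extend_add vir_extend_scale vir_extend_basis commutator_def) simp
  have CL': "?P vir_C (vir_L i)" and LC': "?P (vir_L i) vir_C" for i
    using CL[of i] by (simp_all add: vir_bracket_C E0 commutator_def vir_extend_basis)
  have CC': "?P vir_C vir_C"
    by (simp add: vir_bracket_C E0 commutator_def)
  have L_any: "?P (vir_L i) y" for i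
    by (induction y rule: vir_induct) (intro add_right scale_right LL' LC'; assumption)+
  have C_any: "?P vir_C y"
    by (induction y rule: vir_induct) (intro add_right scale_right CL' CC'; assumption)+
  have "?P x y"
    by (induction x rule: vir_induct) (intro add_left scale_left L_any C_any; assumption)+
  then show ?thesis by blast
qed

lemma lie_representation_vir_extend:
  assumes "\<And>a. Vector_Spaces.linear smul smul (\<phi> a)"
    and "\<And>i j v. commutator (\<phi> (L_index i)) (\<phi> (L_index j)) v
      = smul (of_int (i - j)) (\<phi> (L_index (i + j)) v)
        + smul (if i + j = 0 then of_int (i ^ 3 - i) / 12 else 0) (\<phi> C_index v)"
    and "\<And>i v. commutator (\<phi> C_index) (\<phi> (L_index i)) v = 0"
  shows "lie_representation vir_scale vir_bracket UNIV smul (vir_extend smul \<phi>)"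
  unfolding lie_representation_def
  using linear_vir_extend[of \<phi>] commutator_vir_extend[of \<phi>] assms
  by (simp add: fun_eq_iff vir_extend_add vir_extend_scale)

lemma witt_representation_eq_vir_extend:
  assumes rep: "lie_representation vir_scale vir_bracket {x. Poly_Mapping.keys x \<subseteq> L_index ` I} smul \<rho>"
    and \<phi>: "\<And>i. i \<in> I \<Longrightarrow> \<phi> (L_index i) = \<rho> (vir_L i)"
    and x: "Poly_Mapping.keys x \<subseteq> L_index ` I"
  shows "\<rho> x = vir_extend smul \<phi> x"
proof
  fix v
  let ?G = "{x :: vir. Poly_Mapping.keys x \<subseteq> L_index ` I}"
  let ?s = "\<lambda>a. vir_scale (Poly_Mapping.lookup x a) (Poly_Mapping.single a 1)"
  have add: "\<rho> (x + y) v = \<rho> x v + \<rho> y v" if "x \<in> ?G" "y \<in> ?G" for x y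
    using rep that by (simp add: lie_representation_def)
  have scale: "\<rho> (vir_scale c x) v = smul c (\<rho> x v)" if "x \<in> ?G" for c x
    using rep that by (simp add: lie_representation_def)
  have zero: "\<rho> 0 v = 0" using add[of 0 0] by simp
  have in_G: "?s a \<in> ?G" if "a \<in> L_index ` I" for a
    using that by (intro vir.subspace_scale[OF subspace_keys]) simp
  have "\<rho> (\<Sum>a\<in>A. ?s a) v = (\<Sum>a\<in>A. smul (Poly_Mapping.lookup x a) (\<phi> a v))"
    if "finite A" "A \<subseteq> L_index ` I" for A
    using that
  proof (induction A rule: finite_induct)
    case (insert a A)
    have "(\<Sum>a\<in>A. ?s a) \<in> ?G"
      using insert.prems by (intro vir.subspace_sum[OF subspace_keys] in_G) auto
    moreover have "\<rho> (?s a) v = smul (Poly_Mapping.lookup x a) (\<phi> a v)"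
      using insert.prems scale[of "Poly_Mapping.single a 1"] \<phi> by (auto simp: vir_L_def)
    ultimately show ?case
      using insert.prems insert.IH insert.hyps add[OF in_G[of a]] by simp
  qed (simp add: zero)
  moreover have "x = (\<Sum>a\<in>Poly_Mapping.keys x. ?s a)"
    by (rule poly_mapping_eqI)
      (simp add: lookup_sum lookup_single when_def in_keys_iff if_distrib cong: if_cong)
  ultimately show "\<rho> x v = vir_extend smul \<phi> x v"
    using x by (metis finite_keys vir_extend_def)
qed

end

section \<open>Extension to the Virasoro algebra\<close>

theorem mainTheorem3:
  fixes smul :: "complex \<Rightarrow> 'v::ab_group_add \<Rightarrow> 'v"
    and \<sigma> :: "mat2 \<Rightarrow> 'v \<Rightarrow> 'v"
    and \<Phi>gt \<Phi>lt :: "vir \<Rightarrow> 'v \<Rightarrow> 'v"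
    and T S K :: "'v \<Rightarrow> 'v"
  assumes "vector_space smul"
    and "lie_representation mat2_scale mat2_bracket sl2 smul \<sigma>"
    and nontrivial: "\<exists>A\<in>sl2. \<sigma> A \<noteq> (\<lambda>v. 0)"
    and "Vector_Spaces.linear smul smul T"
    and "lie_representation vir_scale vir_bracket witt_gt smul \<Phi>gt"
    and "extends_sl2 \<Phi>gt \<sigma>"
    and "\<Phi>gt (vir_L 2) = T"
    and "Vector_Spaces.linear smul smul S"
    and "lie_representation vir_scale vir_bracket witt_lt smul \<Phi>lt"
    and "extends_sl2 \<Phi>lt \<sigma>"
    and "\<Phi>lt (vir_L (- 2)) = S"
    and K: "K = (\<lambda>v. smul 4 (\<sigma> sl2_h v) - smul 2 (commutator S T v))"
  shows "((\<exists>\<Phi>. lie_representation vir_scale vir_bracket UNIV smul \<Phi> \<and>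
            (\<forall>x\<in>witt_lt. \<Phi> x = \<Phi>lt x) \<and> (\<forall>x\<in>witt_gt. \<Phi> x = \<Phi>gt x))
          \<longleftrightarrow> (K \<circ> T = T \<circ> K \<and> K \<circ> S = S \<circ> K))
     \<and> (\<forall>\<Phi>. lie_representation vir_scale vir_bracket UNIV smul \<Phi> \<and>
            (\<forall>x\<in>witt_lt. \<Phi> x = \<Phi>lt x) \<and> (\<forall>x\<in>witt_gt. \<Phi> x = \<Phi>gt x)
          \<longrightarrow> \<Phi> vir_C = K)"
proof -
  note vs = \<open>vector_space smul\<close>
  interpret V: vector_space smul by (rule vs)
  note gt_rep = assms(5) and lt_rep = assms(9)
  have gt_mem: "vir_L i \<in> witt_gt" if "- 1 \<le> i" for i
    using that by (simp add: witt_gt_def vir_L_def)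
  have lt_mem: "vir_L i \<in> witt_lt" if "i \<le> 1" for i
    using that by (simp add: witt_lt_def vir_L_def)
  have gt_scale: "\<Phi>gt (vir_scale c x) v = smul c (\<Phi>gt x v)" if "x \<in> witt_gt" for c x v
    using gt_rep that by (simp add: lie_representation_def)
  have lt_scale: "\<Phi>lt (vir_scale c x) v = smul c (\<Phi>lt x v)" if "x \<in> witt_lt" for c x v
    using lt_rep that by (simp add: lie_representation_def)
  have sl2_vectors: "\<Phi>gt (vir_L i) = \<Phi>lt (vir_L i)" if "i \<in> {- 1, 0, 1}" for i
  proof -
    have "\<exists>A\<in>sl2. sl2_embed A = vir_L i"
    proof -
      have "mat2_scale (- 1) sl2_e \<in> sl2" "mat2_scale (- 1 / 2) sl2_h \<in> sl2"
        by (simp_all add: sl2_def mat2_defs trace_def sum_2)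
      moreover have "sl2_embed (mat2_scale (- 1) sl2_e) = vir_L 1"
        "sl2_embed (mat2_scale (- 1 / 2) sl2_h) = vir_L 0"
        by (simp_all add: sl2_embed_def mat2_defs)
      ultimately show ?thesis
        using that sl2_basis_in(2) sl2_embed_basis(1) by blast
    qed
    then show ?thesis using assms(6,10) by (metis extends_sl2_def)
  qed
  \<comment> \<open>On the overlap \<open>{- 1, 0, 1}\<close> the two choices agree, both being given by \<open>\<sigma>\<close>.\<close>
  define A where "A i = (if - 1 \<le> i then \<Phi>gt (vir_L i) else \<Phi>lt (vir_L i))" for i
  have A_gt: "A i = \<Phi>gt (vir_L i)" if "- 1 \<le> i" for i
    using that by (simp add: A_def)
  have A_lt: "A i = \<Phi>lt (vir_L i)" if "i \<le> 1" for i
  proof (cases "i < - 1")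
    case False
    with that have "i \<in> {- 1, 0, 1}" by auto
    then show ?thesis using sl2_vectors by (auto simp: A_def)
  qed (simp add: A_def)
  have A_2: "A 2 = T" and A_m2: "A (- 2) = S"
    using assms(7,11) by (simp_all add: A_def)
  have A_linear: "Vector_Spaces.linear smul smul (A i)" for i
    using gt_rep lt_rep gt_mem[of i] lt_mem[of i]
    by (cases "- 1 \<le> i") (auto simp: A_def lie_representation_def)
  then have A_add: "A i (u + v) = A i u + A i v" and A_smul: "A i (smul c v) = smul c (A i v)"
    for i u v c by (simp_all add: linear_iff_add_scale[OF vs])
  have comm_gt: "commutator (A i) (A j) v = smul (of_int (i - j)) (A (i + j) v)"
    if "- 1 \<le> i" "- 1 \<le> j" for i j v
  proof -
    have "commutator (A i) (A j) v = \<Phi>gt (vir_scale (of_int (i - j)) (vir_L (i + j))) v"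
      using gt_rep gt_mem that
      by (subst witt_bracket[symmetric]) (simp_all add: A_gt lie_representation_def)
    \<comment> \<open>For \<open>i = j = - 1\<close> the index \<open>i + j\<close> leaves the range of \<open>\<Phi>gt\<close>, but its coefficient vanishes.\<close>
    also have "\<dots> = smul (of_int (i - j)) (A (i + j) v)"
    proof (cases "i = j")
      case True
      then show ?thesis using gt_scale[OF gt_mem[of 0], of 0 v] by simp
    next
      case False
      then have "- 1 \<le> i + j" using that by linarith
      then show ?thesis by (simp add: gt_scale gt_mem A_gt)
    qed
    finally show ?thesis .
  qed
  have comm_lt: "commutator (A i) (A j) v = smul (of_int (i - j)) (A (i + j) v)"
    if "i \<le> 1" "j \<le> 1" for i j v
  proof -
    have "commutator (A i) (A j) v = \<Phi>lt (vir_scale (of_int (i - j)) (vir_L (i + j))) v"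
      using lt_rep lt_mem that
      by (subst witt_bracket[symmetric]) (simp_all add: A_lt lie_representation_def)
    also have "\<dots> = smul (of_int (i - j)) (A (i + j) v)"
    proof (cases "i = j")
      case True
      then show ?thesis using lt_scale[OF lt_mem[of 0], of 0 v] by simp
    next
      case False
      then have "i + j \<le> 1" using that by linarith
      then show ?thesis by (simp add: lt_scale lt_mem A_lt)
    qed
    finally show ?thesis .
  qed
  have sl2_h: "\<sigma> sl2_h v = smul (- 2) (A 0 v)" for v
  proof -
    have "\<sigma> sl2_h = \<Phi>gt (vir_scale (- 2) (vir_L 0))"
      using assms(6) sl2_basis_in(3) unfolding extends_sl2_def sl2_embed_basis(2)[symmetric] by simp
    then show ?thesis by (simp only: gt_scale[OF gt_mem] A_gt)
  qed
  have K_A: "K v = smul 2 (commutator (A 2) (A (- 2)) v) - smul 8 (A 0 v)" for v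
    by (simp add: K sl2_h A_2 A_m2 commutator_def V.scale_right_diff_distrib)
  have K_linear: "Vector_Spaces.linear smul smul K"
    unfolding linear_iff_add_scale[OF vs]
    by (simp add: K_A commutator_def A_add A_smul V.scale_right_distrib V.scale_right_diff_distrib mult.commute)

  have central: "\<Phi> vir_C = K"
    if rep: "lie_representation vir_scale vir_bracket UNIV smul \<Phi>"
      and lt: "\<forall>x\<in>witt_lt. \<Phi> x = \<Phi>lt x" and gt: "\<forall>x\<in>witt_gt. \<Phi> x = \<Phi>gt x" for \<Phi>
  proof
    fix v
    have \<Phi>: "\<Phi> (vir_L 2) = A 2" "\<Phi> (vir_L (- 2)) = A (- 2)" "\<Phi> (vir_L 0) = A 0"
      using lt gt gt_mem[of 2] lt_mem[of "- 2"] gt_mem[of 0] A_gt[of 2] A_lt[of "- 2"] A_gt[of 0]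
      by simp_all
    have "commutator (A 2) (A (- 2)) v = \<Phi> (vir_bracket (vir_L 2) (vir_L (- 2))) v"
      using rep by (simp add: lie_representation_def \<Phi>)
    also have "\<dots> = smul 4 (A 0 v) + smul (1 / 2) (\<Phi> vir_C v)"
      using rep by (simp add: vir_bracket_L_L lie_representation_def \<Phi>)
    finally show "\<Phi> vir_C v = K v" by (simp add: K_A V.scale_right_distrib)
  qed
  have commutes: "K \<circ> T = T \<circ> K \<and> K \<circ> S = S \<circ> K"
    if rep: "lie_representation vir_scale vir_bracket UNIV smul \<Phi>"
      and lt: "\<forall>x\<in>witt_lt. \<Phi> x = \<Phi>lt x" and gt: "\<forall>x\<in>witt_gt. \<Phi> x = \<Phi>gt x" for \<Phi>
  proof -
    have \<Phi>: "\<Phi> (vir_L 2) = T" "\<Phi> (vir_L (- 2)) = S"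
      using lt gt gt_mem lt_mem assms(7,11) by simp_all
    have "\<Phi> 0 v = 0" for v
    proof -
      have "\<Phi> (vir_scale 0 0) = (\<lambda>v. smul 0 (\<Phi> 0 v))" using rep unfolding lie_representation_def by blast
      then show ?thesis by simp
    qed
    moreover have "\<Phi> (vir_bracket vir_C x) = commutator (\<Phi> vir_C) (\<Phi> x)" for x
      using rep unfolding lie_representation_def by blast
    ultimately have "commutator (\<Phi> vir_C) (\<Phi> x) v = 0" for x v
      by (metis vir_bracket_C(1))
    from this[of "vir_L 2"] this[of "vir_L (- 2)"] show ?thesis
      by (simp add: \<Phi> central[OF that] commutator_def fun_eq_iff)
  qed
  have extension: "\<exists>\<Phi>. lie_representation vir_scale vir_bracket UNIV smul \<Phi> \<and>
      (\<forall>x\<in>witt_lt. \<Phi> x = \<Phi>lt x) \<and> (\<forall>x\<in>witt_gt. \<Phi> x = \<Phi>gt x)"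
    if KT: "K \<circ> T = T \<circ> K" and KS: "K \<circ> S = S \<circ> K"
  proof -
    define L where "L i = Endo (A i)" for i
    have app_L: "app (L i) = A i" for i
      unfolding L_def by (rule Endo_inverse) (simp add: A_add)
    have app_K: "app (Endo K) = K"
      by (rule Endo_inverse) (use K_linear in \<open>simp add: linear_iff_add_scale[OF vs]\<close>)
    interpret rat_lie_algebra "endo_scale smul" endo_bracket
      by (rule rat_lie_algebra_endo[OF vs])
    note app_simps = app_L app_K app_endo_scale[OF vs] endo_bracket.rep_eq plus_endo.rep_eq
      minus_endo.rep_eq zero_endo.rep_eq
    have app_eqI: "f = g" if "\<And>v. app f v = app g v" for f g :: "'v endo"
      using that by (simp add: app_inject[symmetric] fun_eq_iff)
    interpret witt_pair "endo_scale smul" endo_bracket L "Endo K"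
    proof unfold_locales
      show "endo_bracket (Endo K) (L 2) = 0" "endo_bracket (Endo K) (L (- 2)) = 0"
        using KT KS by (intro app_eqI; simp add: app_simps A_2 A_m2 commutator_def fun_eq_iff)+
      show "Endo K = endo_scale smul 2 (endo_bracket (L 2) (L (- 2))) - endo_scale smul 8 (L 0)"
        by (rule app_eqI) (simp add: app_simps K_A)
    qed (rule app_eqI, simp add: app_simps comm_gt comm_lt of_rat_diff)+
    define \<phi> where "\<phi> a = (case a of L_index i \<Rightarrow> A i | C_index \<Rightarrow> K)" for a
    have \<phi>_simps [simp]: "\<phi> (L_index i) = A i" "\<phi> C_index = K" for i
      by (simp_all add: \<phi>_def)
    have "lie_representation vir_scale vir_bracket UNIV smul (vir_extend smul \<phi>)"
    proof (rule lie_representation_vir_extend[OF vs])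
      show "Vector_Spaces.linear smul smul (\<phi> a)" for a
        using A_linear K_linear by (cases a) simp_all
      fix i j v
      have "app (endo_bracket (L i) (L j)) v = smul (of_int (i - j)) (A (i + j) v)
          + smul (if i + j = 0 then of_int (i ^ 3 - i) / 12 else 0) (K v)"
        unfolding virasoro_relations[of i j] by (simp add: app_simps of_rat_divide of_rat_diff of_rat_power)
      then show "commutator (\<phi> (L_index i)) (\<phi> (L_index j)) v
        = smul (of_int (i - j)) (\<phi> (L_index (i + j)) v)
          + smul (if i + j = 0 then of_int (i ^ 3 - i) / 12 else 0) (\<phi> C_index v)"
        by (simp add: app_simps)
      have "app (endo_bracket (Endo K) (L i)) v = 0"
        by (simp add: K_central zero_endo.rep_eq)
      then show "commutator (\<phi> C_index) (\<phi> (L_index i)) v = 0"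
        by (simp add: app_simps)
    qed
    moreover have "vir_extend smul \<phi> x = \<Phi>lt x" if "x \<in> witt_lt" for x
      using witt_representation_eq_vir_extend[OF vs, of "{..1}" \<Phi>lt \<phi> x] that lt_rep A_lt
      by (simp add: witt_lt_def)
    moreover have "vir_extend smul \<phi> x = \<Phi>gt x" if "x \<in> witt_gt" for x
      using witt_representation_eq_vir_extend[OF vs, of "{- 1..}" \<Phi>gt \<phi> x] that gt_rep A_gt
      by (simp add: witt_gt_def)
    ultimately show ?thesis by blast
  qed
  show ?thesis using central commutes extension by blast
qed

end
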